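(* Let $k$ be a prime number and $m$ a positive integer, and let $e_k(m)$ be the number of partial orders on $\{1,\dots,m+k\}$ whose set of minimal elements is exactly $\{1,\dots,m\}$. Then $e_k(m)-2^{mk}-(-1)^k$ is divisible by $k$. *)

theory Defs
  imports Complex_Main "HOL-Computational_Algebra.Primes"
begin

definition minimal_elements :: "'a set \<Rightarrow> 'a rel \<Rightarrow> 'a set" where
  "minimal_elements A r = {x \<in> A. \<forall>y \<in> A. (y, x) \<in> r \<longrightarrow> y = x}"

text \<open>
  Orders are reflexive relations contained in \<open>A \<times> A\<close>, so each partial order on
  \<open>{1..m + k}\<close> is counted exactly once and the set counted below is finite.
\<close>

definition e :: "nat \<Rightarrow> nat \<Rightarrow> nat" where
  "e k m = card {r. partial_order_on {1..m + k} r \<and> minimal_elements {1..m + k} r = {1..m}}"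

lemma finite_partial_orders_on:
  assumes "finite A"
  shows "finite {r. partial_order_on A r \<and> P r}"
proof (rule finite_subset)
  show "{r. partial_order_on A r \<and> P r} \<subseteq> Pow (A \<times> A)"
    by (auto simp: partial_order_on_def preorder_on_def)
  show "finite (Pow (A \<times> A))"
    using assms by simp
qed

end

theory Submission
  imports Defs "HOL-Number_Theory.Residues"
begin

text \<open>
  A permutation of the non-minimal elements that cycles them transitively has order \<open>k\<close>, so
  \<open>e k m\<close> is congruent modulo \<open>k\<close> to the number of orders invariant under it. In an invariant
  order the \<open>k\<close> non-minimal elements form an antichain and lie above the same nonempty set of
  minimal elements, which leaves \<open>2 ^ m - 1\<close> orders; Fermat's little theorem gives the rest.
\<close>

section \<open>Iterates, prime periods and counting fixed points modulo a prime\<close>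

lemma funpow_mult_fixpoint:
  assumes "(f ^^ n) x = x"
  shows "(f ^^ (n * i)) x = x"
  using assms by (induction i) (simp_all add: funpow_add)

text \<open>By Bezout some multiple of \<open>a\<close> exceeds a multiple of \<open>b\<close> by
  one. Iterating that often returns \<open>x\<close> when read through \<open>a\<close>, and gives
  \<open>f x\<close> when read through \<open>b\<close>.\<close>

lemma funpow_coprime_fixpoint:
  assumes "(f ^^ a) x = x" and "(f ^^ b) x = x" and "coprime a b" and "a \<noteq> 0"
  shows "f x = x"
proof -
  obtain u v where "a * u = b * v + 1"
    using bezout_nat[OF assms(4), of b] assms(3) by auto
  then have "(f ^^ (a * u)) x = f ((f ^^ (b * v)) x)"
    by simp
  then show ?thesis
    using assms by (simp add: funpow_mult_fixpoint)
qed

lemma bij_if_funpow_id: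
  assumes "f ^^ k = id" and "k > 0"
  shows "bij f"
proof (rule o_bij)
  have "f ^^ Suc (k - 1) = id"
    using assms by simp
  then show "f ^^ (k - 1) \<circ> f = id" and "f \<circ> f ^^ (k - 1) = id"
    by (metis funpow_Suc_right, metis funpow.simps(2))
qed

text \<open>If iterates \<open>i < j\<close> agreed, applying \<open>p - i\<close> further steps to
  both would show that \<open>x\<close> also has period \<open>j - i\<close>. This is positive and
  below \<open>p\<close>, hence coprime to \<open>p\<close>, which forces
  \<open>f x = x\<close>.\<close>

lemma inj_on_funpow_prime_period:
  fixes p :: nat
  assumes "prime p" and per: "(f ^^ p) x = x" and "f x \<noteq> x"
  shows "inj_on (\<lambda>i. (f ^^ i) x) {..<p}"
proof (rule linorder_inj_onI')
  fix i j assume ij: "i \<in> {..<p}" "j \<in> {..<p}" "i < j"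
  show "(f ^^ i) x \<noteq> (f ^^ j) x"
  proof
    assume eq: "(f ^^ i) x = (f ^^ j) x"
    define d where "d = j - i"
    have d: "0 < d" "d < p" "p - i + j = d + p"
      using ij by (auto simp: d_def)
    have "x = (f ^^ (p - i + i)) x"
      using ij per by simp
    also have "\<dots> = (f ^^ (p - i + j)) x"
      by (simp only: funpow_add o_apply eq)
    also have "\<dots> = (f ^^ d) x"
      by (simp add: d(3) funpow_add per)
    finally have "(f ^^ d) x = x"
      by simp
    moreover have "coprime d p"
      using d \<open>prime p\<close> by (metis coprime_commute nat_dvd_not_less prime_imp_coprime)
    ultimately show False
      using funpow_coprime_fixpoint[OF _ per] d assms(3) by blast
  qed
qed

text \<open>The orbit of a non-fixed point has exactly \<open>p\<close> elements and contains no
  fixed point, so removing it changes neither side modulo \<open>p\<close>. The induction strips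
  such orbits until only fixed points remain.\<close>

lemma card_cong_card_fixpoints:
  fixes p :: nat
  assumes "finite X" and "prime p" and "f ` X \<subseteq> X" and "\<And>x. x \<in> X \<Longrightarrow> (f ^^ p) x = x"
  shows "[card X = card {x \<in> X. f x = x}] (mod p)"
  using assms(1,3,4)
proof (induction X rule: finite_psubset_induct)
  case (psubset X)
  show ?case
  proof (cases "\<forall>x\<in>X. f x = x")
    case True
    then have "{x \<in> X. f x = x} = X"
      by auto
    then show ?thesis
      by simp
  next
    case False
    then obtain x where x: "x \<in> X" "f x \<noteq> x"
      by auto
    define orb where "orb = (\<lambda>i. (f ^^ i) x) ` {..<p}"
    have p: "p > 0"
      using \<open>prime p\<close> prime_gt_0_nat by blast
    have per: "(f ^^ p) y = y" if "y \<in> X" for y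
      using psubset.prems(2) that .
    have pow_in: "(f ^^ i) y \<in> X" if "y \<in> X" for i y
      using that psubset.prems(1) by (induction i) auto
    have card_orb: "card orb = p"
      unfolding orb_def
      using card_image[OF inj_on_funpow_prime_period[OF \<open>prime p\<close> per[OF x(1)] x(2)]] by simp
    have orb_sub: "orb \<subseteq> X"
      using pow_in x by (auto simp: orb_def)
    have in_orb: "(f ^^ n) x \<in> orb" for n
    proof -
      have "(f ^^ n) x = (f ^^ (n mod p + p * (n div p))) x"
        by simp
      also have "\<dots> = (f ^^ (n mod p)) x"
        by (simp only: funpow_add o_apply funpow_mult_fixpoint[OF per[OF x(1)]])
      finally show ?thesis
        using p by (auto simp: orb_def)
    qed
    have not_fix: "f y \<noteq> y" if "y \<in> orb" for y
    proof
      assume fy: "f y = y"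
      obtain i where i: "i < p" "y = (f ^^ i) x"
        using \<open>y \<in> orb\<close> by (auto simp: orb_def)
      have "x = (f ^^ (p - i + i)) x"
        using i per x by simp
      also have "\<dots> = (f ^^ (p - i)) y"
        by (simp only: funpow_add o_apply i)
      \<comment> \<open>A fixed point is a point of period 1, so every iterate fixes it.\<close>
      also have "\<dots> = y"
        using funpow_mult_fixpoint[of 1 f y] fy by simp
      finally show False
        using fy x by simp
    qed
    have closed: "f ` (X - orb) \<subseteq> X - orb"
    proof clarify
      fix y assume y: "y \<in> X" "y \<notin> orb"
      have "f y \<notin> orb"
      proof
        assume "f y \<in> orb"
        then obtain i where i: "f y = (f ^^ i) x"
          by (auto simp: orb_def)
        \<comment> \<open>On \<open>X\<close> the iterate \<open>f ^^ (p - 1)\<close> undoes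
          \<open>f\<close>, so it would carry \<open>f y\<close> back to \<open>y\<close> along the
          orbit.\<close>
        have "y = (f ^^ Suc (p - 1)) y"
          using p per y by simp
        also have "\<dots> = (f ^^ (p - 1 + i)) x"
          by (simp only: funpow_Suc_right funpow_add o_apply i)
        finally show False
          using y in_orb by metis
      qed
      then show "f y \<in> X - orb"
        using y psubset.prems by auto
    qed
    have "orb \<noteq> {}"
      using card_orb p by auto
    then have "X - orb \<subset> X"
      using orb_sub by auto
    then have "[card (X - orb) = card {x \<in> X - orb. f x = x}] (mod p)"
      using psubset.IH closed per by blast
    moreover have "{x \<in> X - orb. f x = x} = {x \<in> X. f x = x}"
      using not_fix by auto
    moreover have "card X = card (X - orb) + p"
      using card_Diff_subset[OF finite_subset[OF orb_sub psubset.hyps(1)] orb_sub] card_orb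
        card_mono[OF psubset.hyps(1) orb_sub] by simp
    ultimately show ?thesis
      by (simp add: cong_def)
  qed
qed

section \<open>Relabelling an order by pulling it back along a permutation\<close>

lemma funpow_inv_image:
  fixes g :: "'a \<Rightarrow> 'a"
  shows "((\<lambda>r. inv_image r g) ^^ n) r = inv_image r (g ^^ n)"
  by (induction n) (auto simp: in_inv_image funpow_swap1)

lemma partial_order_on_inv_image:
  assumes "partial_order_on A r" and "inj g" and "\<And>x. g x \<in> A \<longleftrightarrow> x \<in> A"
  shows "partial_order_on A (inv_image r g)"
  using assms
  unfolding partial_order_on_def preorder_on_def refl_on_def
  by (auto simp: trans_inv_image intro!: antisymI dest: antisymD injD)

lemma minimal_elements_inv_image:
  assumes "bij g" and "\<And>x. g x \<in> A \<longleftrightarrow> x \<in> A"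
  shows "minimal_elements A (inv_image r g) = g -` minimal_elements A r"
proof -
  have "(\<forall>y\<in>A. (g y, g x) \<in> r \<longrightarrow> y = x) \<longleftrightarrow> (\<forall>z\<in>A. (z, g x) \<in> r \<longrightarrow> z = g x)" for x
    using assms by (metis bij_pointE)
  then show ?thesis
    using assms(2) by (auto simp: minimal_elements_def)
qed

text \<open>Invariance propagates the one comparison to a chain through the iterates of
  \<open>g ^^ n\<close>. Periodicity closes the chain at \<open>x\<close>, and antisymmetry
  collapses it.\<close>

lemma invariant_partial_order_antichain:
  assumes po: "partial_order_on A r" and inv: "inv_image r g = r"
    and "x \<in> A" and "(x, (g ^^ n) x) \<in> r" and per: "(g ^^ k) x = x" and "k > 0"
  shows "(g ^^ n) x = x"
proof -
  have r: "refl_on A r" "trans r" "antisym r" "r \<subseteq> A \<times> A"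
    using po by (auto simp: partial_order_on_def preorder_on_def)
  have inv_pow: "inv_image r (g ^^ i) = r" for i
    using funpow_mult_fixpoint[of 1 "\<lambda>r. inv_image r g" r i] inv
    by (simp add: funpow_inv_image)
  have step: "((g ^^ i) x, (g ^^ (i + n)) x) \<in> r" for i
    using assms(4) inv_pow[of i] by (auto simp: inv_image_def funpow_add)
  have "((g ^^ n) x, (g ^^ (n * Suc j)) x) \<in> r" for j
  proof (induction j)
    case 0
    then show ?case
      using r assms(4) by (auto simp: refl_on_def)
  next
    case (Suc j)
    then show ?case
      using step[of "n * Suc j"] r(2) by (auto simp: add.commute dest: transD)
  qed
  \<comment> \<open>For \<open>j = k - 1\<close> the exponent is \<open>n * k\<close>, a multiple of
    the period.\<close>
  from this[of "k - 1"] have "((g ^^ n) x, x) \<in> r"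
    using \<open>k > 0\<close> funpow_mult_fixpoint[OF per, of n] by (simp add: mult.commute)
  then show ?thesis
    using assms(4) r(3) by (auto dest: antisymD)
qed

section \<open>Classification of the invariant orders\<close>

lemma partial_order_on_two_levels:
  assumes "S \<subseteq> M" and "M \<inter> B = {}"
  shows "partial_order_on (M \<union> B) (Id_on (M \<union> B) \<union> S \<times> B)"
  unfolding partial_order_on_def preorder_on_def refl_on_def
  using assms by (auto intro!: transI antisymI)

text \<open>An element of \<open>S\<close> below all of \<open>B\<close> keeps the elements of
  \<open>B\<close> from being minimal.\<close>

lemma minimal_elements_two_levels:
  assumes "S \<subseteq> M" and "M \<inter> B = {}" and "S \<noteq> {}"
  shows "minimal_elements (M \<union> B) (Id_on (M \<union> B) \<union> S \<times> B) = M"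
  unfolding minimal_elements_def using assms by fastforce

text \<open>Minimality leaves only equality below elements of \<open>M\<close>, and transitivity of
  \<open>g\<close> on \<open>B\<close> makes \<open>B\<close> an antichain. What is left to choose
  is which elements of \<open>M\<close> lie below \<open>B\<close>.\<close>

lemma invariant_partial_orders_eq:
  assumes "M \<inter> B = {}" and "B \<noteq> {}" and "k > 0"
    and per: "\<And>x. (g ^^ k) x = x" and fix_M: "\<And>x. x \<in> M \<Longrightarrow> g x = x"
    and g_B: "\<And>x. g x \<in> B \<longleftrightarrow> x \<in> B"
    and transitive: "\<And>x y. x \<in> B \<Longrightarrow> y \<in> B \<Longrightarrow> \<exists>n. (g ^^ n) x = y"
    and g_M: "\<And>x. g x \<in> M \<longleftrightarrow> x \<in> M"
  shows "{r. partial_order_on (M \<union> B) r \<and> minimal_elements (M \<union> B) r = M \<and> inv_image r g = r} =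
    (\<lambda>S. Id_on (M \<union> B) \<union> S \<times> B) ` (Pow M - {{}})" (is "?L = ?R")
proof (intro equalityI subsetI)
  fix r assume "r \<in> ?R"
  then obtain S where S: "S \<subseteq> M" "S \<noteq> {}" and r: "r = Id_on (M \<union> B) \<union> S \<times> B"
    by blast
  have "inj g"
    using per \<open>k > 0\<close> by (intro bij_is_inj bij_if_funpow_id) auto
  have "g x \<in> S \<longleftrightarrow> x \<in> S" for x
    using S(1) fix_M g_M by (metis subsetD)
  then have "inv_image r g = r"
    using g_B g_M \<open>inj g\<close> by (auto simp: r Id_on_iff dest: injD)
  then show "r \<in> ?L"
    using partial_order_on_two_levels[OF S(1) assms(1)]
      minimal_elements_two_levels[OF S(1) assms(1) S(2)]
    by (simp add: r)
next
  fix r assume "r \<in> ?L"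
  then have po: "partial_order_on (M \<union> B) r" and min: "minimal_elements (M \<union> B) r = M"
    and inv: "inv_image r g = r"
    by auto
  have r: "refl_on (M \<union> B) r" "r \<subseteq> (M \<union> B) \<times> (M \<union> B)"
    using po by (auto simp: partial_order_on_def preorder_on_def)
  obtain b where b: "b \<in> B"
    using assms(2) by auto
  define S where "S = {x \<in> M. (x, b) \<in> r}"
  have antichain: "x = y" if xy: "(x, y) \<in> r" "x \<in> B" "y \<in> B" for x y
  proof -
    obtain n where "y = (g ^^ n) x"
      using transitive xy by metis
    then show ?thesis
      using invariant_partial_order_antichain[OF po inv, of x n k] xy per \<open>k > 0\<close> by auto
  qed
  have below_M: "x = y" if "(x, y) \<in> r" "y \<in> M" for x y
    using that min r(2) by (auto simp: minimal_elements_def)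
  \<comment> \<open>The choice of \<open>b\<close> does not matter: a power of \<open>g\<close>
    carries \<open>b\<close> to \<open>y\<close> while fixing \<open>x\<close>, and \<open>r\<close>
    is invariant under it.\<close>
  have below_B: "(x, y) \<in> r \<longleftrightarrow> x \<in> S" if "x \<in> M" "y \<in> B" for x y
  proof -
    obtain n where n: "(g ^^ n) b = y"
      using transitive[OF b \<open>y \<in> B\<close>] by auto
    have "(g ^^ n) x = x"
      using funpow_mult_fixpoint[of 1 g x n] fix_M[OF \<open>x \<in> M\<close>] by simp
    moreover have "inv_image r (g ^^ n) = r"
      using funpow_mult_fixpoint[of 1 "\<lambda>r. inv_image r g" r n] inv
      by (simp add: funpow_inv_image)
    ultimately have "(x, y) \<in> r \<longleftrightarrow> (x, b) \<in> r"
      using n by (metis in_inv_image)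
    then show ?thesis
      using \<open>x \<in> M\<close> by (simp add: S_def)
  qed
  \<comment> \<open>Some other element lies below \<open>b\<close>; the antichain property places it
    in \<open>M\<close>.\<close>
  have "b \<notin> minimal_elements (M \<union> B) r"
    using min b assms(1) by auto
  then have "S \<noteq> {}"
    using b antichain by (auto simp: minimal_elements_def S_def)
  moreover have "r = Id_on (M \<union> B) \<union> S \<times> B"
  proof (intro equalityI subrelI)
    fix x y assume xy: "(x, y) \<in> r"
    then show "(x, y) \<in> Id_on (M \<union> B) \<union> S \<times> B"
      using r(2) below_M[OF xy] antichain[OF xy] below_B[of x y] by blast
  next
    fix x y assume "(x, y) \<in> Id_on (M \<union> B) \<union> S \<times> B"
    then show "(x, y) \<in> r"
      using r(1) below_B[of x y] by (auto simp: refl_on_def S_def)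
  qed
  moreover have "S \<subseteq> M"
    by (auto simp: S_def)
  ultimately show "r \<in> ?R"
    by blast
qed

lemma card_partial_orders_cong:
  fixes k :: nat
  assumes "finite M" and "finite B" and "M \<inter> B = {}" and "B \<noteq> {}" and "prime k"
    and per: "\<And>x. (g ^^ k) x = x" and fix_M: "\<And>x. x \<in> M \<Longrightarrow> g x = x"
    and g_B: "\<And>x. g x \<in> B \<longleftrightarrow> x \<in> B" and g_M: "\<And>x. g x \<in> M \<longleftrightarrow> x \<in> M"
    and transitive: "\<And>x y. x \<in> B \<Longrightarrow> y \<in> B \<Longrightarrow> \<exists>n. (g ^^ n) x = y"
  shows "[card {r. partial_order_on (M \<union> B) r \<and> minimal_elements (M \<union> B) r = M} =
    2 ^ card M - 1] (mod k)"
proof -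
  let ?X = "{r. partial_order_on (M \<union> B) r \<and> minimal_elements (M \<union> B) r = M}"
  let ?f = "\<lambda>r. inv_image r g"
  have k: "k > 0"
    using \<open>prime k\<close> prime_gt_0_nat by blast
  have "g ^^ k = id"
    using per by auto
  then have "bij g"
    using k by (rule bij_if_funpow_id)
  then have "?f ` ?X \<subseteq> ?X"
    using g_M g_B
    by (auto intro!: partial_order_on_inv_image bij_is_inj simp: minimal_elements_inv_image)
  moreover have "(?f ^^ k) r = r" for r
    by (auto simp: funpow_inv_image \<open>g ^^ k = id\<close>)
  ultimately have "[card ?X = card {r \<in> ?X. ?f r = r}] (mod k)"
    using finite_partial_orders_on[of "M \<union> B"] assms(1,2,5)
    by (intro card_cong_card_fixpoints) auto
  moreover have "{r \<in> ?X. ?f r = r} = (\<lambda>S. Id_on (M \<union> B) \<union> S \<times> B) ` (Pow M - {{}})"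
    using invariant_partial_orders_eq[OF assms(3,4) k per fix_M g_B transitive g_M] by simp
  moreover have "inj_on (\<lambda>S. Id_on (M \<union> B) \<union> S \<times> B) (Pow M - {{}})"
  proof (rule inj_onI)
    fix S T assume ST: "S \<in> Pow M - {{}}" "T \<in> Pow M - {{}}"
      and eq: "Id_on (M \<union> B) \<union> S \<times> B = Id_on (M \<union> B) \<union> T \<times> B"
    \<comment> \<open>The set can be read off from its order, because \<open>M\<close> and
      \<open>B\<close> are disjoint and \<open>B\<close> is nonempty.\<close>
    have "U = {x \<in> M. \<exists>b\<in>B. (x, b) \<in> Id_on (M \<union> B) \<union> U \<times> B}" if "U \<subseteq> M" for U
      using that assms(3,4) by auto
    from this[of S] this[of T] show "S = T"
      using ST eq by simp
  qed
  ultimately show ?thesis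
    using assms(1) by (simp add: card_image card_Pow)
qed

section \<open>The cyclic shift of the non-minimal elements\<close>

definition rotate_above :: "nat \<Rightarrow> nat \<Rightarrow> nat \<Rightarrow> nat" where
  "rotate_above m k i = (if i \<in> {m+1..m+k} then m + 1 + (i - m) mod k else i)"

text \<open>The element with offset \<open>i\<close> from \<open>m + 1\<close> lies
  \<open>i + 1\<close> above \<open>m\<close>, so \<open>(i - m) mod k\<close> in the definition of
  \<open>rotate_above\<close> already advances the offset by one.\<close>

lemma funpow_rotate_above:
  assumes "i < k"
  shows "(rotate_above m k ^^ n) (m + 1 + i) = m + 1 + (i + n) mod k"
proof (induction n)
  case (Suc n)
  have "(i + n) mod k < k"
    using assms by simp
  then show ?case
    using Suc by (simp add: rotate_above_def Suc_leI mod_Suc_eq)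
qed (use assms in simp)

lemma atLeastAtMost_above_obtain:
  assumes "x \<in> {m+1..m+k}"
  obtains i :: nat where "i < k" and "x = m + 1 + i"
proof
  show "x - m - 1 < k" and "x = m + 1 + (x - m - 1)"
    using assms by auto
qed

lemma e_cong:
  assumes "prime k"
  shows "[e k m = 2 ^ m - 1] (mod k)"
proof -
  let ?g = "rotate_above m k"
  let ?M = "{1..m}" and ?B = "{m+1..m+k}"
  have k: "k > 0"
    using assms prime_gt_0_nat by blast
  have outside: "?g x = x" if "x \<notin> ?B" for x
    using that by (auto simp: rotate_above_def)
  have g_B: "?g x \<in> ?B \<longleftrightarrow> x \<in> ?B" for x
    using k by (auto simp: rotate_above_def Suc_leI)
  have g_M: "?g x \<in> ?M \<longleftrightarrow> x \<in> ?M" for x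
    using k by (auto simp: rotate_above_def)
  have per: "(?g ^^ k) x = x" for x
  proof (cases "x \<in> ?B")
    case True
    then obtain i where "i < k" "x = m + 1 + i"
      by (rule atLeastAtMost_above_obtain)
    then show ?thesis
      by (simp only: funpow_rotate_above) simp
  next
    case False
    then show ?thesis
      using funpow_mult_fixpoint[of 1 ?g x k] outside by simp
  qed
  have transitive: "\<exists>n. (?g ^^ n) x = y" if xy: "x \<in> ?B" "y \<in> ?B" for x y
  proof -
    obtain i where i: "i < k" "x = m + 1 + i"
      using xy(1) by (rule atLeastAtMost_above_obtain)
    obtain j where j: "j < k" "y = m + 1 + j"
      using xy(2) by (rule atLeastAtMost_above_obtain)
    \<comment> \<open>The first \<open>k - i\<close> steps wrap around to offset 0 and the next
      \<open>j\<close> reach \<open>y\<close>; this avoids a negative \<open>j - i\<close>.\<close>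
    from i j have "(?g ^^ (k - i + j)) x = y"
      by (simp only: funpow_rotate_above) simp
    then show ?thesis ..
  qed
  have "?M \<union> ?B = {1..m+k}"
    by auto
  then show ?thesis
    using card_partial_orders_cong[of ?M ?B k ?g, OF _ _ _ _ assms per outside g_B g_M transitive] k
    by (auto simp: e_def)
qed

section \<open>Fermat's little theorem and the final congruence\<close>

lemma fermat_little:
  fixes a p :: nat
  assumes "prime p"
  shows "[a ^ p = a] (mod p)"
proof (cases "p dvd a")
  case True
  then show ?thesis
    using prime_gt_0_nat[OF assms] by (auto simp: cong_def mod_eq_0_iff_dvd dvd_power intro: dvd_trans)
next
  case False
  then have "[a * a ^ (p - 1) = a * 1] (mod p)"
    by (intro cong_scalar_left fermat_theorem assms)
  then show ?thesis
    using prime_gt_0_nat[OF assms] by (simp add: power_eq_if)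
qed

theorem theorem6p6:
  fixes k m :: nat
  assumes "prime k" and "m > 0"
  shows "int k dvd int (e k m) - 2 ^ (m * k) - (-1) ^ k"
proof -
  \<comment> \<open>The truncated subtraction in \<open>e_cong\<close> agrees with the integer one
    because \<open>2 ^ m\<close> is at least 1.\<close>
  have "[int (e k m) = 2 ^ m - 1] (mod int k)"
    using e_cong[OF assms(1), of m] by (simp add: cong_int_iff[symmetric] of_nat_diff)
  moreover have "[2 ^ (m * k) = 2 ^ m] (mod int k)"
    using fermat_little[OF assms(1), of "2 ^ m"]
    by (simp add: cong_int_iff[symmetric] power_mult)
  \<comment> \<open>For odd \<open>k\<close> this is an equality; for \<open>k = 2\<close> it holds
    because 1 and -1 agree modulo 2.\<close>
  moreover have "[(-1) ^ k = -1] (mod int k)"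
  proof (cases "k = 2")
    case True
    then show ?thesis
      by (simp add: cong_def)
  next
    case False
    then show ?thesis
      using assms(1) prime_odd_nat[of k] prime_ge_2_nat[of k] by simp
  qed
  ultimately have "[int (e k m) - 2 ^ (m * k) - (-1) ^ k = 2 ^ m - 1 - 2 ^ m - (-1)] (mod int k)"
    by (intro cong_diff)
  then show ?thesis
    by (simp add: cong_0_iff)
qed

end
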